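(* Let $q$ be a prime power, and let $r=r(q)$ and $\epsilon=\epsilon(q)$ be real numbers such that $q^{-r}\ge \frac{\log q}{q}$ and \[ \epsilon=\omega\left(\max\left\{q^{-r},\ \sqrt{q^{r-1}\log\left(q^{1-r}\right)}\right\}\right). \] Let $A_1,\ldots,A_q$ be independently chosen random subsets of $\mathbb{F}_q$, where each element of $\mathbb{F}_q$ is included in $A_i$ independently with probability $q^{-r}(1+\epsilon)$. Then \[ \mathbb{P}\left((A_1\times\cdots\times A_q)\cap \mathrm{RS}[q,rq]=\emptyset\right)=o(1) \] as $q\to\infty$.
   Context: Let $\mathbb{F}_q=\{a_1,\ldots,a_q\}$ be a fixed ordering of the field elements. The Reed–Solomon code $\mathrm{RS}[q,d]\subseteq\mathbb{F}_q^q$ is $\{(P(a_1),\ldots,P(a_q)) : P \text{ a univariate polynomial over } \mathbb{F}_q \text{ of degree at most } d\}$. Here $rq$ is assumed to be an integer. *)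

theory Defs
  imports
    "HOL-Probability.Probability"
    "HOL-Algebra.UnivPoly"
    "HOL-Number_Theory.Prime_Powers"
    "HOL-Library.Landau_Symbols"
begin

text \<open>
  The field is a HOL-Algebra structure \<open>F\<close>, so that it can vary with its order \<open>q\<close> inside one
  statement. The function \<open>a\<close> is the fixed ordering \<open>a 1, \<dots>, a q\<close> of its elements, and words of
  length \<open>q\<close> are extensional functions on \<open>{1..q}\<close>. The zero polynomial has \<open>deg\<close> equal to 0,
  hence it is included for every \<open>d\<close>.
\<close>

definition RS_code ::
    "('a, 'm) ring_scheme \<Rightarrow> (nat \<Rightarrow> 'a) \<Rightarrow> nat \<Rightarrow> nat \<Rightarrow> (nat \<Rightarrow> 'a) set" where
  "RS_code F a q d =
     {(\<lambda>i\<in>{1..q}. eval F F (\<lambda>c. c) (a i) P) | P. P \<in> carrier (UP F) \<and> deg F P \<le> d}"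

definition random_subset_pmf :: "'a set \<Rightarrow> real \<Rightarrow> 'a set pmf" where
  "random_subset_pmf S p =
     map_pmf (\<lambda>b. {x \<in> S. b x}) (Pi_pmf S False (\<lambda>_. bernoulli_pmf p))"

text \<open>The joint law of \<open>n\<close> independent such subsets; \<open>{}\<close> is a dummy value off \<open>{1..n}\<close>.\<close>

definition random_subsets_pmf :: "nat \<Rightarrow> 'a set \<Rightarrow> real \<Rightarrow> (nat \<Rightarrow> 'a set) pmf" where
  "random_subsets_pmf n S p = Pi_pmf {1..n} {} (\<lambda>_. random_subset_pmf S p)"

definition prime_powers_at_top :: "nat filter" where
  "prime_powers_at_top = inf at_top (principal {q. primepow q})"

end

theory Submission
  imports Defs "HOL-Algebra.Multiplicative_Group" "HOL-Combinatorics.Permutations"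
    "HOL-Real_Asymp.Real_Asymp"
begin

text \<open>
  A plain second moment bound on the number of codewords in \<open>A\<^sub>1 \<times> \<dots> \<times> A\<^sub>q\<close> fails, because
  that number inherits the fluctuations of the sizes \<open>|A\<^sub>i|\<close>. Weighting a codeword by the product
  of the factors \<open>q / |A\<^sub>i|\<close> removes them. Let \<open>Y\<close> be the weighted count,
  \<open>\<alpha> = P(A\<^sub>i \<noteq> {})\<close>, and \<open>\<beta>\<close> the expectation of \<open>1 / |A\<^sub>i|\<close> on \<open>A\<^sub>i \<noteq> {}\<close>. A coordinate where two
  codewords agree contributes \<open>g = q \<beta>\<close> to the mean of \<open>Y\<^sup>2\<close>, any other coordinate contributes
  \<open>h = q (\<alpha> - \<beta>) / (q - 1)\<close>, and \<open>h + (g - h) / q = \<alpha>\<close>. Since \<open>d + 1\<close> coordinates determine a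
  codeword, at most \<open>|C|\<^sup>2 / q\<^bsup>|T|\<^esup>\<close> pairs of distinct codewords agree on a set \<open>T\<close>; expanding the
  products over such \<open>T\<close>, the off-diagonal part of the second moment is at most \<open>|C|\<^sup>2 \<alpha>\<^bsup>q\<^esup>\<close>, while
  the mean of \<open>Y\<close> is \<open>|C| \<alpha>\<^bsup>q\<^esup>\<close>. With \<open>m = q\<^bsup>1-r\<^esup> \<ge> log q\<close>, the hypothesis on \<open>\<epsilon>\<close> makes \<open>m \<epsilon>\<close>
  dominate \<open>\<surd>m\<close>, so that \<open>\<alpha>\<^bsup>q\<^esup> \<longrightarrow> 1\<close> and \<open>m \<beta> \<le> 1\<close>, and the diagonal part is relatively at most
  about \<open>1 / q\<close>. Chebyshev's inequality concludes.
  Empty sets need no case distinction in the weights since \<open>1 / 0 = 0\<close>.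
\<close>

section \<open>Counting pairs of codewords that agree on given coordinates\<close>

text \<open>Complete \<open>T\<close> to a set of \<open>k\<close> coordinates by adding
  \<open>U\<close>. A word is determined by its values on \<open>T \<union> U\<close>, and those on
  \<open>T\<close> are prescribed, so only the \<open>k - card T\<close> values on \<open>U\<close>
  are free.\<close>

lemma card_fiber_le:
  fixes C :: "('i \<Rightarrow> 'a) set"
  assumes I: "finite I" and S: "finite S" and C: "C \<subseteq> (\<Pi>\<^sub>E i\<in>I. S)"
    and k: "k \<le> card I"
    and inj: "\<And>T. T \<subseteq> I \<Longrightarrow> card T = k \<Longrightarrow> inj_on (\<lambda>c. restrict c T) C"
    and T: "T \<subseteq> I" "card T \<le> k" and c: "c \<in> C"
  shows "card {c' \<in> C. \<forall>i\<in>T. c i = c' i} \<le> card S ^ (k - card T)"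
proof -
  have finT: "finite T" using T(1) I finite_subset by auto
  have "k - card T \<le> card (I - T)"
    using k T finT by (simp add: card_Diff_subset)
  then obtain U where U: "U \<subseteq> I - T" "card U = k - card T" "finite U"
    by (meson obtain_subset_with_card_n)
  have "card (T \<union> U) = k"
    using U T finT by (subst card_Un_disjoint) auto
  then have inj': "inj_on (\<lambda>c. restrict c (T \<union> U)) C"
    using inj[of "T \<union> U"] T U by auto
  let ?B = "{c' \<in> C. \<forall>i\<in>T. c i = c' i}"
  have "inj_on (\<lambda>c. restrict c U) ?B"
  proof (rule inj_onI)
    fix x y assume xy: "x \<in> ?B" "y \<in> ?B" "restrict x U = restrict y U"
    have "restrict x (T \<union> U) = restrict y (T \<union> U)"
    proof
      fix i show "restrict x (T \<union> U) i = restrict y (T \<union> U) i"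
        using xy(1,2) fun_cong[OF xy(3), of i] by (cases "i \<in> U") auto
    qed
    then show "x = y" using inj' xy by (auto dest: inj_onD)
  qed
  moreover have "(\<lambda>c. restrict c U) ` ?B \<subseteq> (\<Pi>\<^sub>E i\<in>U. S)"
    using C U by fastforce
  ultimately have "card ?B \<le> card (\<Pi>\<^sub>E i\<in>U. S)"
    using U S by (intro card_inj_on_le) (auto intro: finite_PiE)
  then show ?thesis using U by (simp add: card_PiE)
qed

text \<open>The bound is what independent uniform words would give on average. For
  \<open>card T \<le> k\<close> it follows by summing the fibre bound over \<open>c\<close>; beyond
  that, agreement on \<open>k\<close> coordinates already forces equality and no pair is
  left.\<close>

lemma card_agreeing_pairs_le:
  fixes C :: "('i \<Rightarrow> 'a) set"
  assumes I: "finite I" and S: "finite S" "S \<noteq> {}" and C: "C \<subseteq> (\<Pi>\<^sub>E i\<in>I. S)"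
    and k: "k \<le> card I"
    and inj: "\<And>T. T \<subseteq> I \<Longrightarrow> card T = k \<Longrightarrow> inj_on (\<lambda>c. restrict c T) C"
    and cardC: "card C = card S ^ k"
    and T: "T \<subseteq> I"
  shows "real (card {(c, c'). c \<in> C \<and> c' \<in> C \<and> c \<noteq> c' \<and> (\<forall>i\<in>T. c i = c' i)})
           \<le> real (card C) ^ 2 / real (card S) ^ card T" (is "real (card ?P) \<le> _")
proof (cases "card T \<le> k")
  case True
  have S0: "card S > 0" using S by (simp add: card_gt_0_iff)
  have finC: "finite C" using cardC S0 by (metis card.infinite not_gr_zero zero_less_power)
  have "?P \<subseteq> (SIGMA c:C. {c' \<in> C. \<forall>i\<in>T. c i = c' i})" by auto
  then have "card ?P \<le> card (SIGMA c:C. {c' \<in> C. \<forall>i\<in>T. c i = c' i})"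
    using finC by (intro card_mono) auto
  also have "\<dots> = (\<Sum>c\<in>C. card {c' \<in> C. \<forall>i\<in>T. c i = c' i})"
    using finC by (intro card_SigmaI) auto
  also have "\<dots> \<le> (\<Sum>c\<in>C. card S ^ (k - card T))"
    by (intro sum_mono card_fiber_le[OF I S(1) C k inj T True])
  finally have "card ?P \<le> card C * card S ^ (k - card T)" by simp
  then have "real (card ?P) \<le> real (card C) * real (card S) ^ (k - card T)"
    by (simp flip: of_nat_power of_nat_mult)
  also have "\<dots> = real (card C) ^ 2 / real (card S) ^ card T"
    using True S0 by (simp add: cardC power2_eq_square power_diff)
  finally show ?thesis .
next
  case False
  then obtain U where U: "U \<subseteq> T" "card U = k"
    by (metis nat_le_linear obtain_subset_with_card_n)
  have "?P = {}"
  proof -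
    have "c = c'" if "c \<in> C" "c' \<in> C" "\<forall>i\<in>T. c i = c' i" for c c'
    proof -
      have "restrict c U = restrict c' U" using that U by (auto intro!: restrict_ext)
      then show ?thesis using inj[of U] U T that by (auto dest: inj_onD)
    qed
    then show ?thesis by auto
  qed
  then have "card ?P = 0" by (simp only: card.empty)
  then show ?thesis by simp
qed

text \<open>Writing each factor as \<open>h\<close>, plus \<open>g - h\<close> on agreement, expands
  the product over subsets \<open>T\<close> of the agreement set. Since \<open>h\<close> and
  \<open>g - h\<close> are nonnegative, the pair count bounds each term. Each diagonal pair
  contributes \<open>g ^ card I\<close>.\<close>

lemma sum_agreement_weights_le:
  fixes C :: "('i \<Rightarrow> 'a) set" and g h :: real
  assumes I: "finite I" and S: "finite S" "S \<noteq> {}" and C: "C \<subseteq> (\<Pi>\<^sub>E i\<in>I. S)"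
    and k: "k \<le> card I"
    and inj: "\<And>T. T \<subseteq> I \<Longrightarrow> card T = k \<Longrightarrow> inj_on (\<lambda>c. restrict c T) C"
    and cardC: "card C = card S ^ k"
    and gh: "0 \<le> h" "h \<le> g"
  shows "(\<Sum>c\<in>C. \<Sum>c'\<in>C. \<Prod>i\<in>I. if c i = c' i then g else h)
           \<le> real (card C) ^ 2 * (h + (g - h) / card S) ^ card I + card C * g ^ card I"
proof -
  have S0: "card S > 0" using S by (simp add: card_gt_0_iff)
  have finC: "finite C" using cardC S0 by (metis card.infinite not_gr_zero zero_less_power)
  let ?w = "\<lambda>c c'. \<Prod>i\<in>I. if c i = c' i then g else h"
  let ?D = "{(c, c'). c \<in> C \<and> c' \<in> C \<and> c \<noteq> c'}"
  have finD: "finite ?D" by (rule finite_subset[of _ "C \<times> C"]) (use finC in auto)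
  have "(\<Sum>c\<in>C. \<Sum>c'\<in>C. ?w c c') = (\<Sum>(c,c')\<in>C\<times>C. ?w c c')"
    by (rule sum.cartesian_product)
  also have "C \<times> C = ?D \<union> (\<lambda>c. (c, c)) ` C" by auto
  also have "(\<Sum>(c,c')\<in>?D \<union> (\<lambda>c. (c, c)) ` C. ?w c c') =
      (\<Sum>(c,c')\<in>?D. ?w c c') + (\<Sum>(c,c')\<in>(\<lambda>c. (c, c)) ` C. ?w c c')"
    using finC finD by (intro sum.union_disjoint) auto
  also have "(\<Sum>(c,c')\<in>(\<lambda>c. (c, c)) ` C. ?w c c') = card C * g ^ card I"
    by (subst sum.reindex) (auto simp: inj_on_def)
  also have "(\<Sum>(c,c')\<in>?D. ?w c c') \<le> real (card C) ^ 2 * (h + (g - h) / card S) ^ card I"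
  proof -
    have w: "?w c c' = (\<Sum>T\<in>Pow I. if \<forall>i\<in>T. c i = c' i
        then (g - h) ^ card T * h ^ (card I - card T) else 0)" for c c'
    proof -
      have "?w c c' = (\<Prod>i\<in>I. (if c i = c' i then g - h else 0) + h)"
        by (intro prod.cong) auto
      also have "\<dots> = (\<Sum>T\<in>Pow I. (\<Prod>i\<in>T. if c i = c' i then g - h else 0) * (\<Prod>i\<in>I-T. h))"
        by (rule prod_add[OF I])
      also have "\<dots> = (\<Sum>T\<in>Pow I. if \<forall>i\<in>T. c i = c' i
        then (g - h) ^ card T * h ^ (card I - card T) else 0)"
      proof (intro sum.cong refl)
        fix T assume "T \<in> Pow I"
        then have T: "T \<subseteq> I" "finite T" using I finite_subset by auto
        show "(\<Prod>i\<in>T. if c i = c' i then g - h else 0) * (\<Prod>i\<in>I-T. h) =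
          (if \<forall>i\<in>T. c i = c' i then (g - h) ^ card T * h ^ (card I - card T) else 0)"
        proof (cases "\<forall>i\<in>T. c i = c' i")
          case True
          then have "(\<Prod>i\<in>T. if c i = c' i then g - h else 0) = (\<Prod>i\<in>T. g - h)"
            by (intro prod.cong) auto
          then show ?thesis using True T by (simp add: card_Diff_subset)
        next
          case False
          then show ?thesis using T(2) by auto
        qed
      qed
      finally show ?thesis .
    qed
    have "(\<Sum>(c,c')\<in>?D. ?w c c') = (\<Sum>T\<in>Pow I. \<Sum>(c,c')\<in>?D. if \<forall>i\<in>T. c i = c' i
        then (g - h) ^ card T * h ^ (card I - card T) else 0)"
      unfolding w case_prod_beta by (rule sum.swap)
    also have "\<dots> \<le> (\<Sum>T\<in>Pow I. real (card C) ^ 2 *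
        (((g - h) / card S) ^ card T * h ^ (card I - card T)))"
    proof (intro sum_mono)
      fix T assume "T \<in> Pow I"
      then have T: "T \<subseteq> I" by simp
      let ?v = "(g - h) ^ card T * h ^ (card I - card T)"
      let ?P = "{(c, c'). c \<in> C \<and> c' \<in> C \<and> c \<noteq> c' \<and> (\<forall>i\<in>T. c i = c' i)}"
      have "(\<Sum>(c,c')\<in>?D. if \<forall>i\<in>T. c i = c' i then ?v else 0) = (\<Sum>z\<in>?P. ?v)"
        by (rule sum.mono_neutral_cong_right[OF finD]) (auto split: if_splits)
      also have "\<dots> = card ?P * ?v" by simp
      also have "\<dots> \<le> (real (card C) ^ 2 / real (card S) ^ card T) * ?v"
        by (intro mult_right_mono card_agreeing_pairs_le[OF I S C k inj cardC T]) (use gh in auto)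
      also have "\<dots> = real (card C) ^ 2 *
        (((g - h) / card S) ^ card T * h ^ (card I - card T))"
        by (simp add: power_divide)
      finally show "(\<Sum>(c,c')\<in>?D. if \<forall>i\<in>T. c i = c' i then ?v else 0) \<le> \<dots>" .
    qed
    \<comment> \<open>The same expansion read backwards: each element of \<open>T\<close> has
      absorbed one factor \<open>1 / card S\<close>.\<close>
    also have "\<dots> = real (card C) ^ 2 * (\<Sum>T\<in>Pow I. (\<Prod>i\<in>T. (g - h) / card S) * (\<Prod>i\<in>I-T. h))"
      unfolding sum_distrib_left
      by (intro sum.cong refl) (auto simp: card_Diff_subset finite_subset[OF _ I])
    also have "\<dots> = real (card C) ^ 2 * (\<Prod>i\<in>I. (g - h) / card S + h)"
      by (simp only: prod_add[OF I])
    finally show ?thesis by (simp add: add.commute)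
  qed
  finally show ?thesis by linarith
qed

section \<open>Second moment of the weighted codeword count\<close>

text \<open>Chebyshev's inequality for the sum \<open>Y\<close> of the products, where
  \<open>f x A\<close> is the weight that the set \<open>A\<close> gives to the symbol
  \<open>x\<close>. Over a uniform pair of symbols the mean of \<open>f x A * f y A\<close> averages
  to \<alpha>, not \<alpha>^2; this is the source of
  \<open>1 / \<alpha> ^ card I - 1\<close>.\<close>

lemma prob_no_codeword_le:
  fixes C :: "('i \<Rightarrow> 'a) set" and g h \<alpha> :: real
    and D :: "'b pmf" and f :: "'a \<Rightarrow> 'b \<Rightarrow> real"
  assumes I: "finite I" and S: "finite S" "S \<noteq> {}" and C: "C \<subseteq> (\<Pi>\<^sub>E i\<in>I. S)"
    and k: "k \<le> card I"
    and inj: "\<And>T. T \<subseteq> I \<Longrightarrow> card T = k \<Longrightarrow> inj_on (\<lambda>c. restrict c T) C"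
    and cardC: "card C = card S ^ k"
    and gh: "0 \<le> h" "h \<le> g" and \<alpha>: "h + (g - h) / card S = \<alpha>" "\<alpha> > 0"
    and D: "finite (set_pmf D)" and f: "\<And>x A. f x A \<ge> 0"
    and E1: "\<And>x. x \<in> S \<Longrightarrow> measure_pmf.expectation D (f x) = \<alpha>"
    and E2: "\<And>x y. x \<in> S \<Longrightarrow> y \<in> S \<Longrightarrow>
       measure_pmf.expectation D (\<lambda>A. f x A * f y A) = (if x = y then g else h)"
  shows "measure_pmf.prob (Pi_pmf I dflt (\<lambda>_. D)) {A. \<forall>c\<in>C. (\<Prod>i\<in>I. f (c i) (A i)) = 0}
     \<le> 1 / \<alpha> ^ card I - 1 + g ^ card I / (real (card S) ^ k * \<alpha> ^ (2 * card I))"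
proof -
  let ?M = "Pi_pmf I dflt (\<lambda>_. D)"
  define Y where "Y A = (\<Sum>c\<in>C. \<Prod>i\<in>I. f (c i) (A i))" for A
  define n where "n = card I"
  define N where "N = real (card C)"
  have S0: "card S > 0" using S by (simp add: card_gt_0_iff)
  have N: "N = real (card S) ^ k" "N > 0" using S0 by (auto simp: N_def cardC)
  have CS: "c i \<in> S" if "c \<in> C" "i \<in> I" for c i using C that by auto
  have finM: "finite (set_pmf ?M)"
    unfolding set_Pi_pmf[OF I] using I D by (intro finite_PiE_dflt) auto
  note int = integrable_measure_pmf_finite[OF finM] integrable_measure_pmf_finite[OF D]
  have EY: "measure_pmf.expectation ?M Y = N * \<alpha> ^ n"
  proof -
    have "measure_pmf.expectation ?M Y =
        (\<Sum>c\<in>C. measure_pmf.expectation ?M (\<lambda>A. \<Prod>i\<in>I. f (c i) (A i)))"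
      unfolding Y_def by (intro Bochner_Integration.integral_sum int)
    also have "\<dots> = (\<Sum>c\<in>C. \<Prod>i\<in>I. \<alpha>)"
      by (intro sum.cong refl, subst expectation_prod_Pi_pmf)
         (auto simp: I f CS E1 int intro!: prod.cong)
    finally show ?thesis by (simp add: N_def n_def)
  qed
  have "measure_pmf.expectation ?M (\<lambda>A. (Y A)\<^sup>2) =
      (\<Sum>c\<in>C. \<Sum>c'\<in>C. measure_pmf.expectation ?M (\<lambda>A. \<Prod>i\<in>I. f (c i) (A i) * f (c' i) (A i)))"
    unfolding Y_def power2_eq_square sum_product prod.distrib
    by (simp add: Bochner_Integration.integral_sum int)
  also have "\<dots> = (\<Sum>c\<in>C. \<Sum>c'\<in>C. \<Prod>i\<in>I. if c i = c' i then g else h)"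
    by (intro sum.cong refl, subst expectation_prod_Pi_pmf[where f = "\<lambda>i A. f (_ i) A * f (_ i) A"])
       (auto simp: I f CS E2 int intro!: prod.cong)
  also have "\<dots> \<le> N ^ 2 * \<alpha> ^ n + N * g ^ n"
    using sum_agreement_weights_le[OF I S C k inj cardC gh] by (simp add: N_def n_def \<alpha>)
  finally have EY2: "measure_pmf.expectation ?M (\<lambda>A. (Y A)\<^sup>2) \<le> N ^ 2 * \<alpha> ^ n + N * g ^ n" .
  have pos: "N * \<alpha> ^ n > 0" using N \<alpha> by simp
  \<comment> \<open>If all products vanish then \<open>Y A = 0\<close>, which lies at distance
    \<open>N * \<alpha> ^ n\<close> from the mean.\<close>
  have "measure_pmf.prob ?M {A. \<forall>c\<in>C. (\<Prod>i\<in>I. f (c i) (A i)) = 0}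
      \<le> measure_pmf.prob ?M {A \<in> space ?M. \<bar>Y A - measure_pmf.expectation ?M Y\<bar> \<ge> N * \<alpha> ^ n}"
    by (intro measure_pmf.finite_measure_mono) (use pos in \<open>auto simp: Y_def EY\<close>)
  also have "\<dots> \<le> measure_pmf.variance ?M Y / (N * \<alpha> ^ n)\<^sup>2"
    by (intro measure_pmf.Chebyshev_inequality pos int) auto
  also have "measure_pmf.variance ?M Y =
      measure_pmf.expectation ?M (\<lambda>A. (Y A)\<^sup>2) - (N * \<alpha> ^ n)\<^sup>2"
    by (subst measure_pmf.variance_eq) (auto intro: int simp: EY)
  also have "\<dots> / (N * \<alpha> ^ n)\<^sup>2 \<le> (N ^ 2 * \<alpha> ^ n + N * g ^ n - (N * \<alpha> ^ n)\<^sup>2) / (N * \<alpha> ^ n)\<^sup>2"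
    by (intro divide_right_mono) (use EY2 in auto)
  also have "\<dots> = 1 / \<alpha> ^ n - 1 + g ^ n / (N * \<alpha> ^ (2 * n))"
    using N(2) \<alpha>(2) by (simp add: field_simps power2_eq_square mult_2_right power_add)
  finally show ?thesis by (simp add: N(1) n_def)
qed

section \<open>Symmetry and moments of a random subset\<close>

text \<open>The membership indicators are independent with a common law, so relabelling them by
  \<open>\<pi>\<close> does not change their joint law.\<close>

lemma random_subset_pmf_permute:
  assumes "finite S" "\<pi> permutes S"
  shows "map_pmf ((`) \<pi>) (random_subset_pmf S p) = random_subset_pmf S p"
proof -
  let ?M = "Pi_pmf S False (\<lambda>_. bernoulli_pmf p)"
  have "?M = map_pmf (\<lambda>b. b \<circ> \<pi>) ?M"
    by (rule Pi_pmf_bij_betw) (use assms permutes_imp_bij permutes_not_in in fastforce)+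
  then have "map_pmf (\<lambda>b. \<pi> ` {x \<in> S. b x}) ?M =
      map_pmf (\<lambda>b. \<pi> ` {x \<in> S. b x}) (map_pmf (\<lambda>b. b \<circ> \<pi>) ?M)"
    by (rule arg_cong)
  then have "map_pmf ((`) \<pi>) (random_subset_pmf S p) = map_pmf (\<lambda>b. \<pi> ` {x \<in> S. b (\<pi> x)}) ?M"
    unfolding random_subset_pmf_def pmf.map_comp o_def .
  also have "(\<lambda>b. \<pi> ` {x \<in> S. b (\<pi> x)}) = (\<lambda>b. {x \<in> S. b x})"
  proof
    fix b
    have "\<pi> ` {x \<in> S. b (\<pi> x)} = {x \<in> \<pi> ` S. b x}" by auto
    then show "\<pi> ` {x \<in> S. b (\<pi> x)} = {x \<in> S. b x}"
      using permutes_image[OF assms(2)] by simp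
  qed
  finally show ?thesis unfolding random_subset_pmf_def .
qed

lemma set_pmf_random_subset: "set_pmf (random_subset_pmf S p) \<subseteq> Pow S"
  by (auto simp: random_subset_pmf_def)

lemma card_random_subset_pmf:
  assumes "finite S" "p \<in> {0..1}"
  shows "map_pmf card (random_subset_pmf S p) = binomial_pmf (card S) p"
  unfolding random_subset_pmf_def
  by (subst binomial_pmf_altdef'[OF assms(1) refl assms(2), of False]) (simp add: pmf.map_comp o_def)

text \<open>Permutations preserve cardinality, so the invariance of the law carries over. Taking
  \<open>x = y\<close> gives the version for a single point.\<close>

lemma expectation_pair_permute:
  fixes w :: "nat \<Rightarrow> real"
  assumes "finite S" "\<pi> permutes S"
  shows "measure_pmf.expectation (random_subset_pmf S p)
           (\<lambda>A. if \<pi> x \<in> A \<and> \<pi> y \<in> A then w (card A) else 0) =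
         measure_pmf.expectation (random_subset_pmf S p)
           (\<lambda>A. if x \<in> A \<and> y \<in> A then w (card A) else 0)"
proof -
  have inj: "inj \<pi>" using assms(2) permutes_inj by auto
  show ?thesis
    by (subst random_subset_pmf_permute[OF assms, symmetric])
       (simp add: inj_image_mem_iff[OF inj] card_image[OF inj_on_subset[OF inj subset_UNIV]] cong: if_cong)
qed

lemma ex_permutes_pair:
  assumes "x \<in> S" "y \<in> S" "x' \<in> S" "y' \<in> S" "x \<noteq> y" "x' \<noteq> y'"
  obtains \<pi> where "\<pi> permutes S" "\<pi> x = x'" "\<pi> y = y'"
proof
  \<comment> \<open>The first transposition sends \<open>y\<close> to \<open>?z\<close>. The second
    sends \<open>?z\<close> to \<open>y'\<close> and fixes \<open>x'\<close>, because
    \<open>?z\<close> and \<open>y'\<close> both differ from \<open>x'\<close>.\<close>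
  let ?z = "Transposition.transpose x x' y"
  have z: "?z \<noteq> x'" "?z \<in> S" using assms by (auto simp: Transposition.transpose_def)
  show "Transposition.transpose ?z y' \<circ> Transposition.transpose x x' permutes S"
    using assms z by (intro permutes_compose permutes_swap_id)
  show "(Transposition.transpose ?z y' \<circ> Transposition.transpose x x') x = x'" "(Transposition.transpose ?z y' \<circ> Transposition.transpose x x') y = y'"
    using assms z by (auto simp: Transposition.transpose_def)
qed

text \<open>By symmetry all points of \<open>S\<close> have the same expectation, and summing over
  them counts each \<open>A\<close> with multiplicity \<open>card A\<close>.\<close>

lemma card_times_expectation_mem:
  fixes w :: "nat \<Rightarrow> real" and p :: real
  assumes S: "finite S" and x: "x \<in> S"
  defines "D \<equiv> random_subset_pmf S p"
  shows "card S * measure_pmf.expectation D (\<lambda>A. if x \<in> A then w (card A) else 0) =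
         measure_pmf.expectation D (\<lambda>A. card A * w (card A))"
proof -
  have D: "finite (set_pmf D)"
    unfolding D_def using set_pmf_random_subset S by (metis finite_Pow_iff finite_subset)
  have "measure_pmf.expectation D (\<lambda>A. if y \<in> A then w (card A) else 0) =
        measure_pmf.expectation D (\<lambda>A. if x \<in> A then w (card A) else 0)" if "y \<in> S" for y
    using expectation_pair_permute[OF S permutes_swap_id[OF x that], of p x x w]
    by (simp add: D_def)
  then have "card S * measure_pmf.expectation D (\<lambda>A. if x \<in> A then w (card A) else 0) =
      (\<Sum>y\<in>S. measure_pmf.expectation D (\<lambda>A. if y \<in> A then w (card A) else 0))"
    by simp
  also have "\<dots> = measure_pmf.expectation D (\<lambda>A. \<Sum>y\<in>S. if y \<in> A then w (card A) else 0)"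
    by (intro Bochner_Integration.integral_sum [symmetric] integrable_measure_pmf_finite D)
  also have "\<dots> = measure_pmf.expectation D (\<lambda>A. card A * w (card A))"
  proof (intro integral_cong_AE; (simp add: AE_measure_pmf_iff)?; intro ballI)
    fix A assume "A \<in> set_pmf D"
    then have "S \<inter> A = A" using set_pmf_random_subset by (auto simp: D_def)
    then show "(\<Sum>y\<in>S. if y \<in> A then w (card A) else 0) = card A * w (card A)"
      using S by (simp add: sum.If_cases flip: Int_def)
  qed
  finally show ?thesis .
qed

text \<open>The same symmetry argument for ordered pairs of distinct points.\<close>

lemma card_times_expectation_pair:
  fixes w :: "nat \<Rightarrow> real" and p :: real
  assumes S: "finite S" and xy: "x \<in> S" "y \<in> S" "x \<noteq> y"
  defines "D \<equiv> random_subset_pmf S p"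
  shows "real (card S) * (real (card S) - 1) *
           measure_pmf.expectation D (\<lambda>A. if x \<in> A \<and> y \<in> A then w (card A) else 0) =
         measure_pmf.expectation D (\<lambda>A. card A * (real (card A) - 1) * w (card A))"
proof -
  have D: "finite (set_pmf D)"
    unfolding D_def using set_pmf_random_subset S by (metis finite_Pow_iff finite_subset)
  \<comment> \<open>The subtraction is real; for empty \<open>A\<close> the first factor makes the
    product vanish.\<close>
  have card_pairs: "real (card (SIGMA u:A. A - {u})) = card A * (real (card A) - 1)"
    if "finite A" for A :: "'a set"
  proof -
    have "card (SIGMA u:A. A - {u}) = (\<Sum>u\<in>A. card A - 1)"
      using that by (subst card_SigmaI) (auto intro: sum.cong)
    then show ?thesis by (cases "card A") (auto simp: algebra_simps)
  qed
  let ?e = "\<lambda>u v. measure_pmf.expectation D (\<lambda>A. if u \<in> A \<and> v \<in> A then w (card A) else 0)"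
  let ?Q = "SIGMA u:S. S - {u}"
  have finQ: "finite ?Q" using S by auto
  have "?e u v = ?e x y" if uv: "u \<in> S" "v \<in> S" "u \<noteq> v" for u v
  proof -
    obtain \<pi> where "\<pi> permutes S" "\<pi> x = u" "\<pi> y = v"
      using ex_permutes_pair[OF xy(1,2) uv(1,2) xy(3) uv(3)] by blast
    then show ?thesis using expectation_pair_permute[OF S, of \<pi> p x y w] by (simp add: D_def)
  qed
  then have "(\<Sum>(u,v)\<in>?Q. ?e u v) = (\<Sum>(u,v)\<in>?Q. ?e x y)"
    by (intro sum.cong) auto
  also have "\<dots> = real (card S) * (real (card S) - 1) * ?e x y"
    using card_pairs[OF S] by simp
  finally have "real (card S) * (real (card S) - 1) * ?e x y = (\<Sum>(u,v)\<in>?Q. ?e u v)" ..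
  also have "\<dots> = measure_pmf.expectation D
      (\<lambda>A. \<Sum>(u,v)\<in>?Q. if u \<in> A \<and> v \<in> A then w (card A) else 0)"
    unfolding case_prod_beta
    by (intro Bochner_Integration.integral_sum [symmetric] integrable_measure_pmf_finite D)
  also have "\<dots> = measure_pmf.expectation D (\<lambda>A. card A * (real (card A) - 1) * w (card A))"
  proof (intro integral_cong_AE; (simp add: AE_measure_pmf_iff)?; intro ballI)
    fix A assume "A \<in> set_pmf D"
    then have A: "A \<subseteq> S" using set_pmf_random_subset by (auto simp: D_def)
    have "(\<Sum>(u,v)\<in>?Q. if u \<in> A \<and> v \<in> A then w (card A) else 0) =
        (\<Sum>z\<in>(SIGMA u:A. A - {u}). w (card A))"
      by (rule sum.mono_neutral_cong_right[OF finQ]) (use A in \<open>auto split: if_splits\<close>)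
    also have "\<dots> = card A * (real (card A) - 1) * w (card A)"
      using card_pairs[of A] A S by (simp add: finite_subset)
    finally show "(\<Sum>(u,v)\<in>?Q. if u \<in> A \<and> v \<in> A then w (card A) else 0) =
        card A * (real (card A) - 1) * w (card A)" .
  qed
  finally show ?thesis .
qed

lemma expectation_card_random_subset:
  fixes w :: "nat \<Rightarrow> real" and p :: real
  assumes "finite S" "p \<in> {0..1}"
  shows "measure_pmf.expectation (random_subset_pmf S p) (\<lambda>A. w (card A)) =
         (\<Sum>k\<le>card S. real (card S choose k) * p ^ k * (1 - p) ^ (card S - k) * w k)"
proof -
  have "measure_pmf.expectation (random_subset_pmf S p) (\<lambda>A. w (card A)) =
      measure_pmf.expectation (map_pmf card (random_subset_pmf S p)) w" by simp
  then show ?thesis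
    by (simp add: card_random_subset_pmf[OF assms] expectation_binomial_pmf'[OF assms(2)])
qed

lemma binomial_weights_sum:
  "(\<Sum>k\<le>n. real (n choose k) * p ^ k * (1 - p) ^ (n - k)) = 1" for p :: real
  using binomial_ring[of p "1 - p" n] by simp

lemma prob_random_subset_nonempty:
  assumes "finite S" "p \<in> {0..1}"
  shows "measure_pmf.expectation (random_subset_pmf S p) (\<lambda>A. if card A = 0 then 0 else 1) =
         1 - (1 - p) ^ card S"
proof -
  let ?n = "card S"
  let ?b = "\<lambda>k. real (?n choose k) * p ^ k * (1 - p) ^ (?n - k)"
  have "measure_pmf.expectation (random_subset_pmf S p) (\<lambda>A. if card A = 0 then 0 else 1) =
      (\<Sum>k\<le>?n. ?b k * (if k = 0 then 0 else 1))"
    by (rule expectation_card_random_subset[OF assms])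
  also have "\<dots> = (\<Sum>k\<le>?n. ?b k - (if k = 0 then ?b 0 else 0))"
    by (intro sum.cong) auto
  also have "\<dots> = 1 - (1 - p) ^ ?n"
    by (simp add: sum_subtractf binomial_weights_sum)
  finally show ?thesis .
qed

text \<open>The absorption identity: division by \<open>k + 1\<close> turns a weight for
  \<open>n\<close> trials into one for \<open>n + 1\<close> trials, up to a constant.\<close>

lemma binomial_weight_Suc:
  assumes "(p::real) > 0"
  shows "real (n choose k) * p ^ k * (1 - p) ^ (n - k) / (real k + 1) =
         real (Suc n choose Suc k) * p ^ Suc k * (1 - p) ^ (Suc n - Suc k) / ((real n + 1) * p)"
proof -
  have "real (Suc n choose Suc k) * (real k + 1) = (real n + 1) * real (n choose k)"
    using Suc_times_binomial_eq[of n k]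
    by (metis of_nat_Suc of_nat_mult add.commute)
  then have "real (n choose k) / (real k + 1) = real (Suc n choose Suc k) / (real n + 1)"
    by (simp add: frac_eq_eq mult.commute del: binomial_Suc_Suc)
  then have "real (n choose k) / (real k + 1) * (p ^ k * (1 - p) ^ (n - k)) =
      real (Suc n choose Suc k) / (real n + 1) * (p ^ k * (1 - p) ^ (n - k))" by simp
  then show ?thesis using assms by (simp add: ac_simps del: binomial_Suc_Suc)
qed

text \<open>Replacing \<open>1 / k\<close> by products of \<open>1 / (k + 1)\<close> and
  \<open>1 / (k + 2)\<close> lets the binomial weights absorb the denominators; the shifted weights
  sum to at most 1.\<close>

lemma expectation_inverse_card_le:
  fixes p :: real
  assumes S: "finite S" "S \<noteq> {}" and p: "0 < p" "p \<le> 1"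
  defines "\<mu> \<equiv> p * card S"
  shows "measure_pmf.expectation (random_subset_pmf S p) (\<lambda>A. 1 / card A) \<le> 1 / \<mu> + 3 / \<mu> ^ 2"
proof -
  define n where "n = card S"
  define b where "b N k = real (N choose k) * p ^ k * (1 - p) ^ (N - k)" for N k
  have n: "n > 0" using S by (simp add: n_def card_gt_0_iff)
  have b0: "b N k \<ge> 0" for N k using p by (simp add: b_def)
  have shift: "(\<Sum>k\<le>n. b (n + j) (k + j)) \<le> 1" for j
  proof -
    have "(\<Sum>k\<le>n. b (n + j) (k + j)) = sum (b (n + j)) ((\<lambda>k. k + j) ` {..n})"
      by (subst sum.reindex) (auto simp: inj_on_def)
    also have "\<dots> \<le> sum (b (n + j)) {..n + j}"
      by (intro sum_mono2) (auto simp: b0)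
    finally show ?thesis by (simp add: b_def binomial_weights_sum)
  qed
  have bSuc: "b N k / (real k + 1) = b (N + 1) (k + 1) / ((real N + 1) * p)" for N k
    using binomial_weight_Suc[OF p(1), of N k] by (simp add: b_def)
  have step: "b n k * (1 / k) \<le> b (n + 1) (k + 1) / \<mu> + 3 * (b (n + 2) (k + 2) / \<mu> ^ 2)" for k
  proof -
    \<comment> \<open>For \<open>k \<ge> 1\<close> this amounts to \<open>k + 2 \<le> 3 * k\<close>,
      with equality at \<open>k = 1\<close>. At \<open>k = 0\<close> the left side is 0 by
      convention.\<close>
    have "1 / real k \<le> 1 / (real k + 1) + 3 * (1 / ((real k + 1) * (real k + 2)))"
    proof (cases "k = 0")
      case False
      then show ?thesis by (simp add: divide_simps) (simp add: algebra_simps)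
    qed auto
    then have "b n k * (1 / k) \<le> b n k * (1 / (real k + 1) + 3 * (1 / ((real k + 1) * (real k + 2))))"
      by (intro mult_left_mono b0)
    also have "\<dots> = b n k / (real k + 1) + 3 * (b n k / (real k + 1) / (real k + 2))"
      by (simp add: algebra_simps)
    also have "\<dots> = b (n + 1) (k + 1) / ((real n + 1) * p) +
        3 * (b (n + 1) (k + 1) / (real k + 2) / ((real n + 1) * p))"
      unfolding bSuc by (simp add: ac_simps)
    also have "\<dots> = b (n + 1) (k + 1) / ((real n + 1) * p) +
        3 * (b (n + 2) (k + 2) / (((real n + 2) * p) * ((real n + 1) * p)))"
      using bSuc[of "n + 1" "k + 1"] by (simp add: add.commute)
    also have "\<dots> \<le> b (n + 1) (k + 1) / \<mu> + 3 * (b (n + 2) (k + 2) / \<mu> ^ 2)"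
    proof -
      have "\<mu> > 0" "\<mu> \<le> (real n + 1) * p" "\<mu> \<le> (real n + 2) * p"
        using n p by (auto simp: \<mu>_def n_def algebra_simps)
      then show ?thesis
        unfolding power2_eq_square
        by (intro add_mono mult_left_mono divide_left_mono mult_mono mult_pos_pos b0) (use p in auto)
    qed
    finally show ?thesis .
  qed
  have "measure_pmf.expectation (random_subset_pmf S p) (\<lambda>A. 1 / card A) =
      (\<Sum>k\<le>n. b n k * (1 / k))"
    using expectation_card_random_subset[OF S(1), of p "\<lambda>k. 1 / k"] p by (simp add: n_def b_def)
  also have "\<dots> \<le> (\<Sum>k\<le>n. b (n + 1) (k + 1) / \<mu> + 3 * (b (n + 2) (k + 2) / \<mu> ^ 2))"
    by (intro sum_mono step)
  also have "\<dots> = (\<Sum>k\<le>n. b (n + 1) (k + 1)) / \<mu> + 3 * ((\<Sum>k\<le>n. b (n + 2) (k + 2)) / \<mu> ^ 2)"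
    by (simp only: sum.distrib sum_divide_distrib sum_distrib_left)
  also have "\<dots> \<le> 1 / \<mu> + 3 * (1 / \<mu> ^ 2)"
    using p by (intro add_mono mult_left_mono divide_right_mono shift) (auto simp: \<mu>_def)
  finally show ?thesis by simp
qed

section \<open>Size and distance of Reed-Solomon codes\<close>

text \<open>The difference has degree at most \<open>d\<close> and more than \<open>d\<close>
  roots.\<close>

lemma poly_eq_if_eval_eq:
  assumes F: "field F" "finite (carrier F)"
    and P: "P \<in> carrier (UP F)" "deg F P \<le> d" and Q: "Q \<in> carrier (UP F)" "deg F Q \<le> d"
    and T: "T \<subseteq> carrier F" "card T > d"
    and eq: "\<And>x. x \<in> T \<Longrightarrow> eval F F (\<lambda>c. c) x P = eval F F (\<lambda>c. c) x Q"
  shows "P = Q"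
proof (rule ccontr)
  assume "P \<noteq> Q"
  interpret F: field F by fact
  interpret U: UP_domain F "UP F" by unfold_locales
  let ?R = "P \<ominus>\<^bsub>UP F\<^esub> Q"
  have R: "?R \<in> carrier (UP F)" "?R \<noteq> \<zero>\<^bsub>UP F\<^esub>"
    using P Q \<open>P \<noteq> Q\<close> by auto
  have "deg F ?R \<le> max (deg F P) (deg F (\<ominus>\<^bsub>UP F\<^esub> Q))"
    unfolding a_minus_def using P Q by (intro U.deg_add) auto
  then have "deg F ?R \<le> d" using P Q by simp
  have "T \<subseteq> {x \<in> carrier F. eval F F id x ?R = \<zero>\<^bsub>F\<^esub>}"
  proof
    fix x assume x: "x \<in> T"
    then have xF: "x \<in> carrier F" using T by auto
    have "eval F F id x ?R = eval F F id x P \<ominus>\<^bsub>F\<^esub> eval F F id x Q"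
      using P Q xF by (intro U.evalRR_sub) auto
    also have "\<dots> = \<zero>\<^bsub>F\<^esub>"
      using eq[OF x] P Q xF U.carrier_evalRR by (simp add: id_def)
    finally show "x \<in> {x \<in> carrier F. eval F F id x ?R = \<zero>\<^bsub>F\<^esub>}" using xF by simp
  qed
  then have "card T \<le> card {x \<in> carrier F. eval F F id x ?R = \<zero>\<^bsub>F\<^esub>}"
    using F(2) by (intro card_mono) auto
  also have "\<dots> \<le> deg F ?R"
    using U.roots_bound[OF R F(2)] by simp
  finally show False using \<open>deg F ?R \<le> d\<close> T by simp
qed

lemma RS_code_subset:
  assumes "field F" "bij_betw a {1..q} (carrier F)"
  shows "RS_code F a q d \<subseteq> (\<Pi>\<^sub>E i\<in>{1..q}. carrier F)"
proof -
  interpret F: field F by fact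
  interpret U: UP_domain F "UP F" by unfold_locales
  have "eval F F (\<lambda>c. c) (a i) P \<in> carrier F"
    if "i \<in> {1..q}" "P \<in> carrier (UP F)" for i P
    using U.carrier_evalRR[of "a i" P] that bij_betwE[OF assms(2)] by (auto simp: id_def)
  then show ?thesis by (auto simp: RS_code_def)
qed

text \<open>Since \<open>a\<close> is injective, \<open>d + 1\<close> positions are
  \<open>d + 1\<close> distinct evaluation points, enough to determine the polynomial.\<close>

lemma inj_on_restrict_RS_code:
  assumes F: "field F" "finite (carrier F)" and a: "bij_betw a {1..q} (carrier F)"
    and T: "T \<subseteq> {1..q}" "card T = Suc d"
  shows "inj_on (\<lambda>c. restrict c T) (RS_code F a q d)"
proof (rule inj_onI)
  fix c c' assume cc': "c \<in> RS_code F a q d" "c' \<in> RS_code F a q d" "restrict c T = restrict c' T"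
  obtain P where P: "P \<in> carrier (UP F)" "deg F P \<le> d"
    "c = (\<lambda>i\<in>{1..q}. eval F F (\<lambda>c. c) (a i) P)" using cc'(1) by (auto simp: RS_code_def)
  obtain Q where Q: "Q \<in> carrier (UP F)" "deg F Q \<le> d"
    "c' = (\<lambda>i\<in>{1..q}. eval F F (\<lambda>c. c) (a i) Q)" using cc'(2) by (auto simp: RS_code_def)
  have inj: "inj_on a T" using a T by (meson bij_betw_def inj_on_subset)
  have "P = Q"
  proof (rule poly_eq_if_eval_eq[OF F P(1,2) Q(1,2)])
    show "a ` T \<subseteq> carrier F" using a T by (auto simp: bij_betw_def)
    show "card (a ` T) > d" using T by (simp add: card_image[OF inj])
    fix x assume "x \<in> a ` T"
    then obtain i where i: "i \<in> T" "x = a i" by auto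
    then show "eval F F (\<lambda>c. c) x P = eval F F (\<lambda>c. c) x Q"
      using fun_cong[OF cc'(3), of i] T P(3) Q(3) by auto
  qed
  then show "c = c'" using P Q by simp
qed

text \<open>Above, a word is determined by its first \<open>d + 1\<close> positions; below, distinct
  coefficient vectors give distinct words, since all \<open>q > d\<close> field elements are
  evaluation points.\<close>

lemma card_RS_code:
  assumes F: "field F" "card (carrier F) = q" and a: "bij_betw a {1..q} (carrier F)" and d: "d < q"
  shows "card (RS_code F a q d) = q ^ Suc d"
proof (rule antisym)
  have fin: "finite (carrier F)" using F d by (metis card.infinite not_less_zero)
  let ?T = "{1..Suc d}"
  have "inj_on (\<lambda>c. restrict c ?T) (RS_code F a q d)"
    using d by (intro inj_on_restrict_RS_code[OF F(1) fin a]) auto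
  moreover have "(\<lambda>c. restrict c ?T) ` RS_code F a q d \<subseteq> (\<Pi>\<^sub>E i\<in>?T. carrier F)"
    using RS_code_subset[OF F(1) a, of d] d by fastforce
  ultimately have "card (RS_code F a q d) \<le> card (\<Pi>\<^sub>E i\<in>?T. carrier F)"
    by (intro card_inj_on_le finite_PiE fin) auto
  then show "card (RS_code F a q d) \<le> q ^ Suc d" by (simp add: card_PiE F)
next
  interpret F: field F by fact
  interpret U: UP_domain F "UP F" by unfold_locales
  have fin: "finite (carrier F)" using F d by (metis card.infinite not_less_zero)
  have finRS: "finite (RS_code F a q d)"
    by (rule finite_subset[OF RS_code_subset[OF F(1) a]]) (auto intro: finite_PiE fin)
  \<comment> \<open>Elements of \<open>UP F\<close> are coefficient functions, so a vector of
    \<open>d + 1\<close> coefficients is padded with zeros.\<close>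
  define poly where "poly v = (\<lambda>i. if i \<le> d then v i else \<zero>\<^bsub>F\<^esub>)" for v :: "nat \<Rightarrow> 'a"
  define word where "word v = (\<lambda>i\<in>{1..q}. eval F F (\<lambda>c. c) (a i) (poly v))" for v
  let ?V = "\<Pi>\<^sub>E i\<in>{..d}. carrier F"
  have poly: "poly v \<in> carrier (UP F)" "deg F (poly v) \<le> d" if "v \<in> ?V" for v
  proof -
    show c: "poly v \<in> carrier (UP F)"
      using that by (auto simp: UP_def poly_def intro!: mem_upI exI[of _ d] bound.intro)
    show "deg F (poly v) \<le> d"
      by (rule U.deg_aboveI[OF _ c]) (use c in \<open>auto simp: UP_def poly_def\<close>)
  qed
  have "inj_on word ?V"
  proof (rule inj_onI)
    fix u v assume uv: "u \<in> ?V" "v \<in> ?V" "word u = word v"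
    have "poly u = poly v"
    proof (rule poly_eq_if_eval_eq[OF F(1) fin poly[OF uv(1)] poly[OF uv(2)] subset_refl])
      show "card (carrier F) > d" using d F by simp
      fix x assume "x \<in> carrier F"
      then obtain i where i: "i \<in> {1..q}" "x = a i" using a by (metis bij_betw_def imageE)
      then show "eval F F (\<lambda>c. c) x (poly u) = eval F F (\<lambda>c. c) x (poly v)"
        using fun_cong[OF uv(3), of i] by (simp add: word_def)
    qed
    then have "u i = v i" if "i \<le> d" for i
      using that by (metis poly_def)
    then show "u = v" using uv by (intro PiE_ext[of u _ _ v]) auto
  qed
  moreover have "word ` ?V \<subseteq> RS_code F a q d"
    using poly by (auto simp: word_def RS_code_def)
  ultimately have "card ?V \<le> card (RS_code F a q d)"
    by (intro card_inj_on_le finRS)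
  then show "q ^ Suc d \<le> card (RS_code F a q d)" by (simp add: card_PiE F)
qed

section \<open>Avoidance probability for a fixed field size\<close>

lemma prob_random_subsets_avoid_le:
  fixes p :: real and C :: "(nat \<Rightarrow> 'a) set"
  assumes n: "card S = n" "n \<ge> 2" and C: "C \<subseteq> (\<Pi>\<^sub>E i\<in>{1..n}. S)"
    and k: "k \<le> n"
    and inj: "\<And>T. T \<subseteq> {1..n} \<Longrightarrow> card T = k \<Longrightarrow> inj_on (\<lambda>c. restrict c T) C"
    and cardC: "card C = n ^ k"
    and p: "0 < p" "p \<le> 1"
  defines "\<alpha> \<equiv> 1 - (1 - p) ^ n"
    and "\<beta> \<equiv> measure_pmf.expectation (random_subset_pmf S p) (\<lambda>A. 1 / card A)"
  shows "measure_pmf.prob (random_subsets_pmf n S p) {A. (\<Pi>\<^sub>E i\<in>{1..n}. A i) \<inter> C = {}}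
           \<le> 1 / \<alpha> ^ n - 1 + (n * \<beta>) ^ n / (real n ^ k * \<alpha> ^ (2 * n))"
proof -
  let ?D = "random_subset_pmf S p"
  let ?E = "measure_pmf.expectation ?D"
  \<comment> \<open>Over all symbols of \<open>S\<close>, every nonempty \<open>A\<close>
    distributes the same total weight \<open>n\<close>, whatever its size.\<close>
  define f where "f x A = (if x \<in> A then n / card A else 0)" for x :: 'a and A
  define g where "g = n * \<beta>"
  define h where "h = n * (\<alpha> - \<beta>) / (real n - 1)"
  have S: "finite S" "S \<noteq> {}" using n by (auto intro: card_ge_0_finite)
  have D: "finite (set_pmf ?D)"
    using set_pmf_random_subset S by (metis finite_Pow_iff finite_subset)
  note int = integrable_measure_pmf_finite[OF D]
  have \<alpha>_eq: "?E (\<lambda>A. if card A = 0 then 0 else 1) = \<alpha>"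
    using prob_random_subset_nonempty[OF S(1), of p] p n by (simp add: \<alpha>_def)
  have "(1 - p) ^ n < 1"
    using p n power_decreasing[of 1 n "1 - p"] by simp
  then have \<alpha>_pos: "\<alpha> > 0" by (simp add: \<alpha>_def)
  have "\<beta> \<le> ?E (\<lambda>A. if card A = 0 then 0 else 1)"
    unfolding \<beta>_def by (intro integral_mono int) (auto simp: field_simps)
  then have \<beta>_le: "\<beta> \<le> \<alpha>" by (simp add: \<alpha>_eq)
  \<comment> \<open>This bound, from \<open>card A \<le> n\<close>, is what makes
    \<open>h \<le> g\<close>.\<close>
  have "?E (\<lambda>A. if card A = 0 then 0 else 1) \<le> ?E (\<lambda>A. n * (1 / card A))"
  proof (intro integral_mono_AE int; unfold AE_measure_pmf_iff; intro ballI)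
    fix A assume "A \<in> set_pmf ?D"
    then have "card A \<le> n"
      using card_mono[of S A] set_pmf_random_subset S n by fastforce
    then show "(if card A = 0 then 0 else 1) \<le> n * (1 / real (card A))"
      by (simp add: field_simps)
  qed
  then have \<alpha>_le: "\<alpha> \<le> n * \<beta>" by (simp only: \<alpha>_eq \<beta>_def integral_mult_right_zero)
  have E1: "?E (f x) = \<alpha>" if "x \<in> S" for x
  proof -
    have "n * ?E (f x) = ?E (\<lambda>A. card A * (n / card A))"
      using card_times_expectation_mem[OF S(1) that, of p "\<lambda>m. n / m"] n by (simp add: f_def[abs_def])
    also have "(\<lambda>A. card A * (n / card A)) = (\<lambda>A :: 'a set. real n * (if card A = 0 then 0 else 1))"
      by auto
    finally show ?thesis using n by (simp add: \<alpha>_eq)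
  qed
  have E2: "?E (\<lambda>A. f x A * f y A) = (if x = y then g else h)" if xy: "x \<in> S" "y \<in> S" for x y
  proof (cases "x = y")
    case True
    have "n * ?E (\<lambda>A. f x A * f y A) = n * ?E (\<lambda>A. if x \<in> A then (n / card A) ^ 2 else 0)"
      unfolding True f_def by (intro arg_cong2[of _ _ _ _ "(*)"] refl Bochner_Integration.integral_cong)
        (auto simp: power2_eq_square)
    also have "\<dots> = ?E (\<lambda>A. card A * (n / card A) ^ 2)"
      using card_times_expectation_mem[OF S(1) xy(1), of p "\<lambda>m. (n / m) ^ 2"] n by simp
    also have "(\<lambda>A. card A * (n / card A) ^ 2) = (\<lambda>A :: 'a set. n ^ 2 * (1 / card A))"
      by (auto simp: power2_eq_square)
    also have "?E \<dots> = n * g"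
      unfolding integral_mult_right_zero by (simp add: g_def \<beta>_def power2_eq_square)
    finally show ?thesis using n True by simp
  next
    case False
    have "n * (real n - 1) * ?E (\<lambda>A. f x A * f y A) =
        n * (real n - 1) * ?E (\<lambda>A. if x \<in> A \<and> y \<in> A then (n / card A) ^ 2 else 0)"
      unfolding f_def by (intro arg_cong2[of _ _ _ _ "(*)"] refl Bochner_Integration.integral_cong)
        (auto simp: power2_eq_square)
    also have "\<dots> = ?E (\<lambda>A. card A * (real (card A) - 1) * (n / card A) ^ 2)"
      using card_times_expectation_pair[OF S(1) xy False, of p "\<lambda>m. (n / m) ^ 2"] n by simp
    \<comment> \<open>For nonempty \<open>A\<close> this is
      \<open>(card A - 1) / card A = 1 - 1 / card A\<close>, scaled; for empty \<open>A\<close> both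
      sides are 0.\<close>
    also have "(\<lambda>A. card A * (real (card A) - 1) * (n / card A) ^ 2) =
        (\<lambda>A :: 'a set. real n ^ 2 * (if card A = 0 then 0 else 1) - real n ^ 2 * (1 / card A))"
      by (auto simp: power2_eq_square field_simps)
    also have "?E \<dots> = real n ^ 2 * \<alpha> - real n ^ 2 * \<beta>"
      by (simp only: Bochner_Integration.integral_diff[OF int int] integral_mult_right_zero \<alpha>_eq \<beta>_def)
    also have "\<dots> = n * (real n - 1) * h"
      using n by (simp add: h_def power2_eq_square field_simps)
    finally show ?thesis using n False by simp
  qed
  have gh: "0 \<le> h" "h \<le> g"
  proof -
    show "0 \<le> h" using \<beta>_le n by (simp add: h_def)
    have "n * (\<alpha> - \<beta>) \<le> n * (\<beta> * (real n - 1))"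
      using \<alpha>_le by (intro mult_left_mono) (auto simp: algebra_simps)
    then show "h \<le> g" using n by (simp add: h_def g_def field_simps)
  qed
  have mean: "h + (g - h) / card S = \<alpha>"
  proof -
    have "h * (real n - 1) = n * (\<alpha> - \<beta>)" using n by (simp add: h_def)
    then have "h * n + (g - h) = n * \<alpha>" by (simp add: g_def algebra_simps)
    then show ?thesis using n by (simp add: field_simps)
  qed
  have "measure_pmf.prob (random_subsets_pmf n S p) {A. (\<Pi>\<^sub>E i\<in>{1..n}. A i) \<inter> C = {}} \<le>
    measure_pmf.prob (Pi_pmf {1..n} {} (\<lambda>_. ?D)) {A. \<forall>c\<in>C. (\<Prod>i\<in>{1..n}. f (c i) (A i)) = 0}"
    unfolding random_subsets_pmf_def
  proof (intro measure_pmf.finite_measure_mono subsetI CollectI ballI; simp?)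
    fix A c assume "(\<Pi>\<^sub>E i\<in>{Suc 0..n}. A i) \<inter> C = {}" "c \<in> C"
    \<comment> \<open>As \<open>c\<close> is extensional, it can leave the box only by having some
      \<open>c i\<close> outside \<open>A i\<close>, and that factor is 0.\<close>
    moreover from this have "c \<notin> (\<Pi>\<^sub>E i\<in>{1..n}. A i)" "c \<in> extensional {1..n}"
      using C by (auto simp: PiE_def)
    ultimately obtain i where "i \<in> {1..n}" "c i \<notin> A i" unfolding PiE_def by blast
    then show "\<exists>i\<in>{Suc 0..n}. f (c i) (A i) = 0" by (auto simp: f_def)
  qed
  also have "\<dots> \<le> 1 / \<alpha> ^ card {1..n} - 1 +
      g ^ card {1..n} / (real (card S) ^ k * \<alpha> ^ (2 * card {1..n}))"
    by (rule prob_no_codeword_le[OF _ S C _ inj _ gh mean \<alpha>_pos D _ E1 E2])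
      (use k cardC n in \<open>auto simp: f_def\<close>)
  finally show ?thesis using n by (simp add: g_def)
qed

text \<open>\<open>\<delta>\<close> bounds the expected number of empty sets, and Bernoulli's
  inequality turns this into \<open>1 - \<delta> \<le> \<alpha> ^ q\<close>. The code has
  \<open>q ^ Suc d\<close> words while \<open>(q * \<beta>) ^ q\<close> is at most
  \<open>q ^ d\<close>, so a factor \<open>1 / q\<close> remains in the diagonal term.\<close>

lemma prob_avoid_RS_code_le:
  fixes p \<delta> :: real
  assumes F: "field F" "card (carrier F) = q" and a: "bij_betw a {1..q} (carrier F)"
    and q: "q \<ge> 2" and d: "d < q" and p: "0 < p" "p \<le> 1"
    and \<delta>: "q * (1 - p) ^ q \<le> \<delta>" "\<delta> < 1"
    and \<mu>: "q * (1 / (p * q) + 3 / (p * q) ^ 2) \<le> x" "x ^ q \<le> q ^ d"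
  shows "measure_pmf.prob (random_subsets_pmf q (carrier F) p)
           {A. (\<Pi>\<^sub>E i\<in>{1..q}. A i) \<inter> RS_code F a q d = {}}
         \<le> 1 / (1 - \<delta>) - 1 + 1 / (q * (1 - \<delta>) ^ 2)"
proof -
  define \<alpha> where "\<alpha> = 1 - (1 - p) ^ q"
  define \<beta> where "\<beta> = measure_pmf.expectation (random_subset_pmf (carrier F) p) (\<lambda>A. 1 / card A)"
  have fin: "finite (carrier F)" "carrier F \<noteq> {}" using F q by (auto intro: card_ge_0_finite)
  have "1 - \<delta> \<le> 1 + real q * (- ((1 - p) ^ q))" using \<delta> by simp
  also have "\<dots> \<le> (1 + - ((1 - p) ^ q)) ^ q"
    using p by (intro Bernoulli_inequality) (auto intro: power_le_one)
  finally have \<alpha>: "1 - \<delta> \<le> \<alpha> ^ q" by (simp add: \<alpha>_def)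
  have "q * \<beta> \<le> q * (1 / (p * q) + 3 / (p * q) ^ 2)"
    unfolding \<beta>_def using expectation_inverse_card_le[OF fin p] F by (intro mult_left_mono) auto
  then have "q * \<beta> \<le> x" using \<mu> by linarith
  moreover have "\<beta> \<ge> 0" unfolding \<beta>_def by (intro integral_nonneg_AE) auto
  ultimately have "(q * \<beta>) ^ q \<le> x ^ q" by (intro power_mono) auto
  then have \<beta>: "(q * \<beta>) ^ q \<le> q ^ d" using \<mu> by linarith
  have "measure_pmf.prob (random_subsets_pmf q (carrier F) p)
           {A. (\<Pi>\<^sub>E i\<in>{1..q}. A i) \<inter> RS_code F a q d = {}}
         \<le> 1 / \<alpha> ^ q - 1 + (q * \<beta>) ^ q / (real q ^ Suc d * \<alpha> ^ (2 * q))"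
    unfolding \<alpha>_def \<beta>_def
    by (rule prob_random_subsets_avoid_le[OF F(2) q RS_code_subset[OF F(1) a] _
          inj_on_restrict_RS_code[OF F(1) fin(1) a] card_RS_code[OF F a d] p]) (use d in auto)
  also have "\<dots> \<le> 1 / (1 - \<delta>) - 1 + real q ^ d / (real q ^ Suc d * (1 - \<delta>) ^ 2)"
  proof -
    have "1 / \<alpha> ^ q \<le> 1 / (1 - \<delta>)" using \<alpha> \<delta> by (intro divide_left_mono) auto
    moreover have "(1 - \<delta>) ^ 2 \<le> \<alpha> ^ (2 * q)"
      using \<alpha> \<delta> power_mono[OF \<alpha>, of 2] by (simp add: mult.commute flip: power_mult)
    then have "(q * \<beta>) ^ q / (real q ^ Suc d * \<alpha> ^ (2 * q)) \<le> real q ^ d / (real q ^ Suc d * (1 - \<delta>) ^ 2)"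
      using \<beta> \<delta> q by (intro frac_le mult_left_mono) auto
    ultimately show ?thesis by linarith
  qed
  also have "\<dots> = 1 / (1 - \<delta>) - 1 + 1 / (q * (1 - \<delta>) ^ 2)" using q by simp
  finally show ?thesis .
qed

section \<open>Asymptotics along the prime powers\<close>

theorem mainTheorem3:
  fixes F :: "nat \<Rightarrow> ('a, 'm) ring_scheme"
    and a :: "nat \<Rightarrow> nat \<Rightarrow> 'a"
    and r \<epsilon> :: "nat \<Rightarrow> real"
  assumes field: "\<And>q. primepow q \<Longrightarrow> field (F q)"
    and order: "\<And>q. primepow q \<Longrightarrow> card (carrier (F q)) = q"
    and ordering: "\<And>q. primepow q \<Longrightarrow> bij_betw (a q) {1..q} (carrier (F q))"
    and rq_integer: "\<And>q. primepow q \<Longrightarrow> r q * real q \<in> \<int>"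
    and r_bound: "\<And>q. primepow q \<Longrightarrow> real q powr (- r q) \<ge> ln (real q) / real q"
    and eps_nonneg: "\<And>q. primepow q \<Longrightarrow> \<epsilon> q \<ge> 0"
    and prob_le_1: "\<And>q. primepow q \<Longrightarrow> real q powr (- r q) * (1 + \<epsilon> q) \<le> 1"
    and eps_omega: "\<epsilon> \<in> \<omega>[prime_powers_at_top](\<lambda>q. max (real q powr (- r q))
                      (sqrt (real q powr (r q - 1) * ln (real q powr (1 - r q)))))"
  shows "(\<lambda>q. measure_pmf.prob
              (random_subsets_pmf q (carrier (F q)) (real q powr (- r q) * (1 + \<epsilon> q)))
              {A. (\<Pi>\<^sub>E i\<in>{1..q}. A i) \<inter> RS_code (F q) (a q) q (nat \<lfloor>r q * real q\<rfloor>) = {}})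
         \<in> o[prime_powers_at_top](\<lambda>_. 1)"
proof -
  \<comment> \<open>What remains of \<open>q * exp (- m * (1 + \<epsilon> q))\<close> once
    \<open>exp (- m)\<close> has cancelled the factor \<open>q\<close>.\<close>
  define \<delta> where "\<delta> q = exp (- sqrt (ln (real q)))" for q :: nat
  define B where "B q = 1 / (1 - \<delta> q) - 1 + 1 / (real q * (1 - \<delta> q) ^ 2)" for q :: nat
  let ?prob = "\<lambda>q. measure_pmf.prob
      (random_subsets_pmf q (carrier (F q)) (real q powr (- r q) * (1 + \<epsilon> q)))
      {A. (\<Pi>\<^sub>E i\<in>{1..q}. A i) \<inter> RS_code (F q) (a q) q (nat \<lfloor>r q * real q\<rfloor>) = {}}"
  have le_top: "prime_powers_at_top \<le> at_top" by (simp add: prime_powers_at_top_def)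
  have ev_pp: "eventually primepow prime_powers_at_top"
    by (simp add: prime_powers_at_top_def eventually_inf_principal)
  have "eventually (\<lambda>q::nat. ln (real q) \<ge> exp 1) at_top" by real_asymp
  then have ev_ln: "eventually (\<lambda>q::nat. ln (real q) \<ge> exp 1) prime_powers_at_top"
    using le_top by (auto simp: le_filter_def)
  \<comment> \<open>The constant 3 matches the one in
    \<open>expectation_inverse_card_le\<close>.\<close>
  have ev_eps: "eventually (\<lambda>q. 3 * norm (max (real q powr (- r q))
      (sqrt (real q powr (r q - 1) * ln (real q powr (1 - r q))))) \<le> norm (\<epsilon> q)) prime_powers_at_top"
    using landau_omega.smallD[OF eps_omega, of 3] by simp
  have prob_le: "eventually (\<lambda>q. ?prob q \<le> B q) prime_powers_at_top"
    using ev_pp ev_ln ev_eps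
  proof eventually_elim
    case (elim q)
    note pp = elim(1)
    define m where "m = real q powr (1 - r q)"
    define p where "p = real q powr (- r q) * (1 + \<epsilon> q)"
    have q: "q \<ge> 2" using pp primepow_gt_Suc_0 by (metis Suc_leI numeral_2_eq_2)
    have \<epsilon>0: "\<epsilon> q \<ge> 0" by (rule eps_nonneg[OF pp])
    have m_eq: "m = q * real q powr (- r q)"
      using q powr_add[of q 1 "- r q"] by (simp add: m_def)
    have m_ge: "m \<ge> ln q" using r_bound[OF pp] q by (simp add: m_eq field_simps)
    have m_e: "m \<ge> exp 1" using m_ge elim(2) by linarith
    have m1: "m \<ge> 1" using m_e exp_ge_add_one_self[of 1] by linarith
    have m_inv: "real q powr (r q - 1) = 1 / m"
      using powr_minus_divide[of "real q" "1 - r q"] by (simp add: m_def)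
    \<comment> \<open>This is why \<open>ln q \<ge> exp 1\<close> was required: the square root in
      the maximum is now at least \<open>1 / sqrt m\<close>.\<close>
    have "1 \<le> ln m" using m_e m1 by (simp add: ln_ge_iff)
    then have "1 / sqrt m \<le> sqrt (1 / m * ln m)"
      using m1 by (simp add: real_sqrt_divide divide_right_mono flip: real_sqrt_mult)
    also have "\<dots> \<le> norm (max (real q powr (- r q)) (sqrt (1 / m * ln m)))" by simp
    finally have "3 * (1 / sqrt m) \<le> \<epsilon> q"
      using elim(3) \<epsilon>0 unfolding m_inv m_def[symmetric] by simp
    then have "m * (3 * (1 / sqrt m)) \<le> m * \<epsilon> q"
      using m1 by (intro mult_left_mono) auto
    moreover have "m * (3 * (1 / sqrt m)) = 3 * sqrt m"
      using m1 by (simp add: field_simps)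
    ultimately have m_eps: "3 * sqrt m \<le> m * \<epsilon> q" by simp
    have sqrt_m1: "sqrt m \<ge> 1" using m1 by simp
    have p: "0 < p" "p \<le> 1"
      using prob_le_1[OF pp] \<epsilon>0 q by (auto simp: p_def)
    have pq: "p * q = m * (1 + \<epsilon> q)" by (simp add: p_def m_eq)
    \<comment> \<open>That the inclusion probability is at most 1 forces \<open>r q \<ge> 0\<close>;
      below, \<open>m > 1\<close> forces \<open>r q < 1\<close>. Hence \<open>d\<close> is exactly
      \<open>r q * q\<close>, and \<open>d < q\<close>.\<close>
    have "real q powr (- r q) \<le> real q powr (- r q) * (1 + \<epsilon> q)"
      using \<epsilon>0 by (simp add: algebra_simps)
    then have "real q powr (- r q) \<le> 1"
      using prob_le_1[OF pp] by (rule order_trans)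
    then have "real q powr (- r q) \<le> real q powr 0" using q by simp
    then have r0: "r q \<ge> 0" using q powr_le_cancel_iff[of "real q" "- r q" 0] by linarith
    have "m > 1" using m_e exp_gt_one[of "1::real"] by linarith
    then have "real q powr (1 - r q) > real q powr 0" using q by (simp add: m_def)
    then have r1: "r q < 1" using q powr_less_cancel_iff[of "real q" 0 "1 - r q"] by linarith
    define d where "d = nat \<lfloor>r q * real q\<rfloor>"
    have d: "real d = r q * real q"
      using rq_integer[OF pp] r0 by (auto simp: d_def elim!: Ints_cases)
    have "real d < real q" using d r1 q by simp
    then have dq: "d < q" by simp
    have "q * (1 - p) ^ q \<le> q * exp (- p) ^ q"
      using p exp_ge_add_one_self[of "- p"] by (intro mult_left_mono power_mono) auto
    also have "exp (- p) ^ q = exp (- m) * exp (- (m * \<epsilon> q))"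
      using pq by (simp add: algebra_simps flip: exp_of_nat_mult exp_add)
    \<comment> \<open>\<open>m \<ge> ln q\<close> pays for the union over \<open>q\<close>
      coordinates; \<open>m * \<epsilon> q \<ge> 3 * sqrt m\<close> gives the decaying
      factor.\<close>
    also have "q * (exp (- m) * exp (- (m * \<epsilon> q))) \<le> q * (exp (- ln q) * exp (- sqrt (ln q)))"
    proof (intro mult_left_mono mult_mono)
      have "sqrt (ln q) \<le> sqrt m" using m_ge by simp
      then have "sqrt (ln q) \<le> m * \<epsilon> q" using m_eps sqrt_m1 by linarith
      then show "exp (- (m * \<epsilon> q)) \<le> exp (- sqrt (ln q))" by simp
    qed (use m_ge in auto)
    also have "\<dots> = \<delta> q" using q by (simp add: \<delta>_def exp_minus)
    finally have \<delta>: "q * (1 - p) ^ q \<le> \<delta> q" .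
    have \<delta>1: "\<delta> q < 1" using q by (simp add: \<delta>_def)
    \<comment> \<open>Here \<open>p * q = m * (1 + \<epsilon> q)\<close>. The correction
      \<open>3 / (p * q)\<close> is at most \<open>\<epsilon> q\<close>, so the surplus
      \<open>1 + \<epsilon> q\<close> in the density absorbs it and
      \<open>q / m = q powr r q\<close> is left, whose \<open>q\<close>-th power is
      \<open>q ^ d\<close>.\<close>
    have x: "q * (1 / (p * q) + 3 / (p * q) ^ 2) \<le> real q powr r q"
    proof -
      have pos: "p * q > 0" using p q by simp
      have "3 \<le> m * \<epsilon> q" using m_eps sqrt_m1 by linarith
      also have "\<dots> \<le> p * q * \<epsilon> q"
        using \<epsilon>0 m1 unfolding pq by (intro mult_right_mono) (auto simp: algebra_simps)
      finally have "3 / (p * q) \<le> \<epsilon> q" using pos by (simp add: field_simps)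
      then have "1 / (p * q) * (1 + 3 / (p * q)) \<le> 1 / (p * q) * (1 + \<epsilon> q)"
        using pos by (intro mult_left_mono) auto
      also have "\<dots> = 1 / m" using \<epsilon>0 m1 unfolding pq by simp
      finally have "1 / (p * q) + 3 / (p * q) ^ 2 \<le> 1 / m"
        by (simp add: distrib_left power2_eq_square)
      then have "q * (1 / (p * q) + 3 / (p * q) ^ 2) \<le> q * (1 / m)"
        by (intro mult_left_mono) auto
      also have "\<dots> = real q powr r q" using q by (simp add: m_eq powr_minus field_simps)
      finally show ?thesis .
    qed
    have "(real q powr r q) ^ q = (real q powr r q) powr real q"
      using q by (simp add: powr_realpow)
    also have "\<dots> = real q powr real d" by (simp add: powr_powr d)
    also have "\<dots> = real q ^ d" using q by (simp add: powr_realpow)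
    finally have xq: "(real q powr r q) ^ q \<le> real q ^ d" by simp
    show ?case
      using prob_avoid_RS_code_le[OF field[OF pp] order[OF pp] ordering[OF pp] q dq p \<delta> \<delta>1 x] xq
      by (simp add: B_def p_def d_def)
  qed
  have B0: "(B \<longlongrightarrow> 0) prime_powers_at_top"
  proof (rule tendsto_mono[OF le_top])
    show "B \<longlonglongrightarrow> 0" unfolding B_def \<delta>_def by real_asymp
  qed
  have "(?prob \<longlongrightarrow> 0) prime_powers_at_top"
    by (rule tendsto_sandwich[OF always_eventually[OF allI[OF measure_nonneg]] prob_le tendsto_const B0])
  then show ?thesis
    by (intro smalloI_tendsto) (simp_all only: div_by_1 one_neq_zero not_False_eq_True eventually_True)
qed

end
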